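(* Let $n\ge1$ and $0<\beta_0<\beta_1\le\alpha$. Then $E_\alpha$ is strongly concave on $[\beta_0,\beta_1]$ with concavity parameter $\frac{1}{2\beta_1^2}\frac{n}{n+1}\left[\frac{1}{\beta_1}-\frac{1}{\alpha}\right]$. In particular, if $t\in[0,1]$ and $\beta_t=(1-t)\beta_0+t\beta_1$, then $$E_\alpha(\beta_t)\ge(1-t)E_\alpha(\beta_0)+tE_\alpha(\beta_1)+\frac{t(1-t)}{4\beta_1^2}\frac{n}{n+1}\left[\frac{1}{\beta_1}-\frac{1}{\alpha}\right](\beta_1-\beta_0)^2.$$
   Context: $\mathcal{P}(\mathbb{R}^n)$ is the set of Borel probability measures on $\mathbb{R}^n$. For $0<\beta\le\alpha$, $\mathcal{E}_{\alpha,\beta}[\mu]=\frac12\iint_{\mathbb{R}^n\times\mathbb{R}^n}\left(\frac{|x-y|^\alpha}{\alpha}-\frac{|x-y|^\beta}{\beta}\right)d\mu(x)d\mu(y)$ and $E_\alpha(\beta):=\inf_{\mu\in\mathcal{P}(\mathbb{R}^n)}\mathcal{E}_{\alpha,\beta}[\mu]$. A function $f$ is strongly concave on $[a,b]$ with concavity parameter $m$ if for all $x_0,x_1\in[a,b]$ and $t\in[0,1]$, $f((1-t)x_0+tx_1)\ge(1-t)f(x_0)+tf(x_1)+t(1-t)\frac{m}{2}(x_0-x_1)^2$. *)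

theory Defs
  imports "HOL-Probability.Probability"
begin

definition borel_probs :: "'a::topological_space measure set" where
  "borel_probs = {\<mu>. prob_space \<mu> \<and> sets \<mu> = sets borel}"

(* Integral in the extended sense: the Bochner integral would assign the value 0
   to a function that is not integrable. It has its usual meaning unless
   both parts have infinite integral. *)
definition ext_integral :: "'a measure \<Rightarrow> ('a \<Rightarrow> real) \<Rightarrow> ereal" where
  "ext_integral M f =
     enn2ereal (\<integral>\<^sup>+ x. ennreal (f x) \<partial>M) - enn2ereal (\<integral>\<^sup>+ x. ennreal (- f x) \<partial>M)"

definition interaction :: "real \<Rightarrow> real \<Rightarrow> 'a::real_normed_vector \<Rightarrow> real" where
  "interaction \<alpha> \<beta> z = norm z powr \<alpha> / \<alpha> - norm z powr \<beta> / \<beta>"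

(* Since 0 < \<beta> \<le> \<alpha>, the interaction is bounded below (lemma interaction_ge), so the energy of a
   probability measure is a well-defined element of (-\<infinity>, \<infinity>]. *)
definition energy :: "real \<Rightarrow> real \<Rightarrow> (real ^ 'n::finite) measure \<Rightarrow> ereal" where
  "energy \<alpha> \<beta> \<mu> =
     ereal (1 / 2) * ext_integral (\<mu> \<Otimes>\<^sub>M \<mu>) (\<lambda>(x, y). interaction \<alpha> \<beta> (x - y))"

(* The infimum is taken in ereal and is finite for 0 < \<beta> \<le> \<alpha> (lemma ereal_min_energy),
   so the conversion to real loses nothing. The space R^n is fixed by the type argument,
   n = CARD('n). *)
definition min_energy :: "'n::finite itself \<Rightarrow> real \<Rightarrow> real \<Rightarrow> real" where
  "min_energy _ \<alpha> \<beta> =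
     real_of_ereal (INF \<mu>\<in>(borel_probs :: (real ^ 'n) measure set). energy \<alpha> \<beta> \<mu>)"

definition strongly_concave_on :: "real \<Rightarrow> real \<Rightarrow> real \<Rightarrow> (real \<Rightarrow> real) \<Rightarrow> bool" where
  "strongly_concave_on a b m f \<longleftrightarrow>
     (\<forall>x0\<in>{a..b}. \<forall>x1\<in>{a..b}. \<forall>t\<in>{0..1}.
        f ((1 - t) * x0 + t * x1) \<ge>
          (1 - t) * f x0 + t * f x1 + t * (1 - t) * (m / 2) * (x0 - x1)\<^sup>2)"

lemma interaction_ge:
  assumes "0 < \<beta>" "\<beta> \<le> \<alpha>"
  shows "interaction \<alpha> \<beta> z \<ge> 1 / \<alpha> - 1 / \<beta>"
proof (cases "z = 0")
  case True
  then show ?thesis using assms by (simp add: interaction_def field_simps)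
next
  case False
  have "(norm z powr \<alpha>) powr (\<beta> / \<alpha>) * 1 powr (1 - \<beta> / \<alpha>)
      \<le> \<beta> / \<alpha> * norm z powr \<alpha> + (1 - \<beta> / \<alpha>) * 1"
    using assms False by (intro Youngs_inequality_0) auto
  then have "norm z powr \<beta> \<le> \<beta> / \<alpha> * norm z powr \<alpha> + (1 - \<beta> / \<alpha>)"
    using assms by (simp add: powr_powr)
  then have "norm z powr \<beta> / \<beta> \<le> (\<beta> / \<alpha> * norm z powr \<alpha> + (1 - \<beta> / \<alpha>)) / \<beta>"
    using assms by (intro divide_right_mono) auto
  also have "\<dots> = norm z powr \<alpha> / \<alpha> + 1 / \<beta> - 1 / \<alpha>"
    using assms by (simp add: field_simps)
  finally show ?thesis by (simp add: interaction_def)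
qed

lemma energy_ge:
  fixes \<mu> :: "(real ^ 'n::finite) measure"
  assumes "0 < \<beta>" "\<beta> \<le> \<alpha>" "\<mu> \<in> borel_probs"
  shows "energy \<alpha> \<beta> \<mu> \<ge> ereal ((1 / \<alpha> - 1 / \<beta>) / 2)"
proof -
  define c where "c = 1 / \<beta> - 1 / \<alpha>"
  have c: "c \<ge> 0" using assms by (simp add: c_def field_simps)
  interpret M: prob_space \<mu> using assms by (simp add: borel_probs_def)
  interpret P: pair_prob_space \<mu> \<mu> ..
  let ?f = "\<lambda>(x, y). interaction \<alpha> \<beta> (x - y :: real ^ 'n)"
  have "(\<integral>\<^sup>+ p. ennreal (- ?f p) \<partial>(\<mu> \<Otimes>\<^sub>M \<mu>)) \<le> (\<integral>\<^sup>+ p. ennreal c \<partial>(\<mu> \<Otimes>\<^sub>M \<mu>))"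
  proof (intro nn_integral_mono ennreal_leI)
    fix p :: "(real ^ 'n) \<times> (real ^ 'n)"
    show "- ?f p \<le> c"
      using interaction_ge[OF assms(1,2), of "fst p - snd p"] by (simp add: c_def split_beta)
  qed
  also have "\<dots> = ennreal c"
    by (simp add: P.emeasure_space_1)
  finally have "enn2ereal (\<integral>\<^sup>+ p. ennreal (- ?f p) \<partial>(\<mu> \<Otimes>\<^sub>M \<mu>)) \<le> ereal c"
    using c by (metis enn2ereal_ennreal less_eq_ennreal.rep_eq)
  then have "0 - ereal c \<le> ext_integral (\<mu> \<Otimes>\<^sub>M \<mu>) ?f"
    unfolding ext_integral_def by (intro ereal_minus_mono) auto
  then have "ereal (1 / 2) * (0 - ereal c) \<le> energy \<alpha> \<beta> \<mu>"
    unfolding energy_def by (intro ereal_mult_left_mono) auto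
  then show ?thesis by (simp add: c_def)
qed

lemma energy_return: "energy \<alpha> \<beta> (return borel (0 :: real ^ 'n::finite)) = 0"
proof -
  let ?D = "return borel (0 :: real ^ 'n)"
  interpret D: prob_space ?D by (rule prob_space_return) simp
  interpret P: pair_prob_space ?D ?D ..
  have z: "(\<integral>\<^sup>+ p. g p \<partial>(?D \<Otimes>\<^sub>M ?D)) = g (0, 0)"
    if "g \<in> borel_measurable (borel \<Otimes>\<^sub>M borel)" for g
  proof -
    have g: "g \<in> borel_measurable (?D \<Otimes>\<^sub>M ?D)"
      using that by (simp cong: measurable_cong_sets sets_pair_measure_cong)
    have "(\<integral>\<^sup>+ p. g p \<partial>(?D \<Otimes>\<^sub>M ?D)) = (\<integral>\<^sup>+ x. \<integral>\<^sup>+ y. g (x, y) \<partial>?D \<partial>?D)"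
      using D.nn_integral_fst[OF g] by simp
    also have "\<dots> = g (0, 0)"
      using that by (simp add: nn_integral_return)
    finally show ?thesis .
  qed
  show ?thesis
    unfolding energy_def ext_integral_def interaction_def by (subst z; (subst z)?) (auto simp: split_beta)
qed

lemma ereal_min_energy:
  assumes "0 < \<beta>" "\<beta> \<le> \<alpha>"
  shows "ereal (min_energy TYPE('n::finite) \<alpha> \<beta>) =
    (INF \<mu>\<in>(borel_probs :: (real ^ 'n) measure set). energy \<alpha> \<beta> \<mu>)"
proof -
  let ?I = "INF \<mu>\<in>(borel_probs :: (real ^ 'n) measure set). energy \<alpha> \<beta> \<mu>"
  have "ereal ((1 / \<alpha> - 1 / \<beta>) / 2) \<le> ?I"
    using energy_ge[OF assms] by (intro INF_greatest) auto
  moreover have "return borel 0 \<in> (borel_probs :: (real ^ 'n) measure set)"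
    by (simp add: borel_probs_def prob_space_return)
  then have "?I \<le> 0"
    by (metis INF_lower energy_return)
  ultimately have "\<bar>?I\<bar> \<noteq> \<infinity>" by auto
  then show ?thesis by (simp add: min_energy_def ereal_real)
qed

end

theory Submission
  imports Defs
begin

text \<open>
  In the variable \<open>b = 1 / \<beta>\<close> the attractive term \<open>r powr \<beta> / \<beta> = b * exp (ln r / b)\<close> is the
  perspective of the exponential function, hence convex for every distance \<open>r\<close>. So every energy is
  concave in \<open>b\<close>, and so is their infimum. Writing \<open>F b = - E (1 / b)\<close> for the negative of the
  minimal energy, \<open>F\<close> is convex for \<open>b \<ge> 1 / \<alpha>\<close>, and \<open>F (1 / \<alpha>) = 0\<close> because the interaction
  vanishes identically at \<open>\<beta> = \<alpha>\<close>.

  A convex function that vanishes at \<open>1 / \<alpha>\<close> grows at least at the rate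
  \<open>F b / (b - 1 / \<alpha>)\<close> beyond \<open>b\<close>. The uniform measure on the \<open>n + 1\<close> vertices of a regular simplex
  of side 1 bounds this rate below by \<open>n / (2 * (n + 1))\<close>: two independent vertices differ with
  probability \<open>n / (n + 1)\<close>, and then contribute \<open>1 / \<alpha> - 1 / \<beta>\<close>.

  Since \<open>F\<close> is convex and increases at that rate, and \<open>1 / \<beta>\<close> is itself strictly convex in
  \<open>\<beta>\<close>, the composition is strongly convex in \<open>\<beta>\<close>: the convexity gap of \<open>1 / \<beta>\<close> along a segment,
  at least \<open>t * (1 - t) * (x\<^sub>0 - x\<^sub>1)\<^sup>2 / \<beta>\<^sub>1 ^ 3\<close>, is passed on by \<open>F\<close> with the factor
  \<open>n / (2 * (n + 1))\<close>. This is proved by comparing values at three points of the segment, in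
  \<open>min_energy_reciprocal_concave\<close>, \<open>min_energy_le_simplex\<close> and \<open>min_energy_concavity_gap\<close>, and
  yields the concavity parameter \<open>n / ((n + 1) * \<beta>\<^sub>1 ^ 3)\<close>, which is larger than the stated one.
\<close>

section \<open>Convexity of the interaction in the reciprocal exponent\<close>

text \<open>
  The left-hand side is, as a function of \<open>c\<close>, the tangent at \<open>c = b\<close> of the convex function
  \<open>c * exp (ln r / c)\<close>; dividing by \<open>c * r powr (1 / b)\<close> reduces the bound to \<open>1 + s \<le> exp s\<close>.
\<close>

lemma reciprocal_powr_tangent:
  fixes r b c :: real
  assumes "0 < r" "0 < b" "0 < c"
  shows "r powr (1 / b) * (c + ln r * (1 - c / b)) \<le> c * r powr (1 / c)"
proof -
  have "r powr (1 / b) * (c + ln r * (1 - c / b))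
      = c * (r powr (1 / b) * (1 + (ln r / c - ln r / b)))"
    using assms by (simp add: field_simps)
  also have "\<dots> \<le> c * (r powr (1 / b) * exp (ln r / c - ln r / b))"
    using assms by (intro mult_left_mono exp_ge_add_one_self) auto
  also have "r powr (1 / b) * exp (ln r / c - ln r / b) = r powr (1 / c)"
    using assms by (simp add: powr_def flip: exp_add)
  finally show ?thesis .
qed

text \<open>
  The assumption on \<open>1 / \<beta>\<close> makes it the convex combination of \<open>1 / \<beta>\<^sub>0\<close>, \<open>1 / \<beta>\<^sub>1\<close> and
  \<open>1 / \<alpha>\<close> in which \<open>1 / \<alpha>\<close> takes the remaining weight \<open>1 - u\<^sub>0 - u\<^sub>1\<close>. That third point costs
  nothing, as the interaction vanishes there, and it is what lets concavity also express growth.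
\<close>

lemma interaction_reciprocal_concave:
  fixes z :: "'a::real_normed_vector"
  assumes pos: "0 < \<alpha>" "0 < \<beta>" "0 < \<beta>\<^sub>0" "0 < \<beta>\<^sub>1"
    and u: "0 \<le> u\<^sub>0" "0 \<le> u\<^sub>1" "u\<^sub>0 + u\<^sub>1 \<le> 1"
    and b: "1 / \<beta> - 1 / \<alpha> = u\<^sub>0 * (1 / \<beta>\<^sub>0 - 1 / \<alpha>) + u\<^sub>1 * (1 / \<beta>\<^sub>1 - 1 / \<alpha>)"
  shows "u\<^sub>0 * interaction \<alpha> \<beta>\<^sub>0 z + u\<^sub>1 * interaction \<alpha> \<beta>\<^sub>1 z \<le> interaction \<alpha> \<beta> z"
proof (cases "z = 0")
  case True
  then show ?thesis by (simp add: interaction_def)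
next
  case False
  define r where "r = norm z"
  define v where "v = 1 - u\<^sub>0 - u\<^sub>1"
  define T where "T c = r powr \<beta> * (c + ln r * (1 - c * \<beta>))" for c
  have tangent: "T (1 / \<gamma>) \<le> r powr \<gamma> / \<gamma>" if "0 < \<gamma>" for \<gamma>
    using reciprocal_powr_tangent[of r "1 / \<beta>" "1 / \<gamma>"] that pos False
    by (simp add: T_def r_def)
  have comb: "1 / \<beta> = v * (1 / \<alpha>) + u\<^sub>0 * (1 / \<beta>\<^sub>0) + u\<^sub>1 * (1 / \<beta>\<^sub>1)"
    using b by (simp add: v_def algebra_simps add_divide_distrib)
  \<comment> \<open>\<open>T\<close> is affine and touches the curve at \<open>1 / \<beta>\<close>.\<close>
  have "r powr \<beta> / \<beta> = T (1 / \<beta>)"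
    using pos by (simp add: T_def)
  also have "\<dots> = v * T (1 / \<alpha>) + u\<^sub>0 * T (1 / \<beta>\<^sub>0) + u\<^sub>1 * T (1 / \<beta>\<^sub>1)"
    unfolding comb T_def v_def by algebra
  also have "\<dots> \<le> v * (r powr \<alpha> / \<alpha>) + u\<^sub>0 * (r powr \<beta>\<^sub>0 / \<beta>\<^sub>0) + u\<^sub>1 * (r powr \<beta>\<^sub>1 / \<beta>\<^sub>1)"
    using pos u by (intro add_mono mult_left_mono tangent) (auto simp: v_def)
  finally show ?thesis
    by (simp add: interaction_def r_def v_def algebra_simps add_divide_distrib diff_divide_distrib)
qed

section \<open>Energies as Bochner integrals\<close>

lemma interaction_measurable [measurable]:
  "(\<lambda>(x, y). interaction \<alpha> \<beta> (x - y))
     \<in> borel_measurable (borel \<Otimes>\<^sub>M (borel :: (real ^ 'n::finite) measure))"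
  unfolding interaction_def by measurable

lemma energy_eq_integral:
  assumes "integrable (\<mu> \<Otimes>\<^sub>M \<mu>) (\<lambda>(x, y). interaction \<alpha> \<beta> (x - y))"
  shows "energy \<alpha> \<beta> \<mu> = ereal (1 / 2 * (\<integral>(x, y). interaction \<alpha> \<beta> (x - y) \<partial>(\<mu> \<Otimes>\<^sub>M \<mu>)))"
proof -
  have "enn2ereal x = ereal (enn2real x)" if "x \<noteq> \<infinity>" for x
    using that by (cases x) auto
  then show ?thesis
    using assms unfolding energy_def ext_integral_def real_integrable_def
    by (simp add: real_lebesgue_integral_def[OF assms])
qed

text \<open>
  The kernel is bounded below, so its negative part always has a finite integral and only the
  positive part can make the energy infinite.
\<close>

lemma integrable_if_energy_finite:
  fixes \<mu> :: "(real ^ 'n::finite) measure"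
  assumes \<beta>: "0 < \<beta>" "\<beta> \<le> \<alpha>" and \<mu>: "\<mu> \<in> borel_probs" and fin: "energy \<alpha> \<beta> \<mu> \<noteq> \<infinity>"
  shows "integrable (\<mu> \<Otimes>\<^sub>M \<mu>) (\<lambda>(x, y). interaction \<alpha> \<beta> (x - y))"
proof -
  let ?f = "\<lambda>(x, y). interaction \<alpha> \<beta> (x - y :: real ^ 'n)"
  interpret M: prob_space \<mu> using \<mu> by (simp add: borel_probs_def)
  interpret P: pair_prob_space \<mu> \<mu> ..
  have sets [measurable_cong]: "sets \<mu> = sets borel"
    using \<mu> by (simp add: borel_probs_def)
  have "(\<integral>\<^sup>+ p. ennreal (- ?f p) \<partial>(\<mu> \<Otimes>\<^sub>M \<mu>)) \<le> (\<integral>\<^sup>+ p. ennreal (1 / \<beta> - 1 / \<alpha>) \<partial>(\<mu> \<Otimes>\<^sub>M \<mu>))"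
  proof (intro nn_integral_mono ennreal_leI)
    fix p :: "(real ^ 'n) \<times> (real ^ 'n)"
    show "- ?f p \<le> 1 / \<beta> - 1 / \<alpha>"
      using interaction_ge[OF \<beta>, of "fst p - snd p"] by (simp add: split_beta)
  qed
  also have "\<dots> < \<infinity>"
    by (simp add: P.emeasure_space_1)
  finally have neg: "(\<integral>\<^sup>+ p. ennreal (- ?f p) \<partial>(\<mu> \<Otimes>\<^sub>M \<mu>)) \<noteq> \<infinity>"
    by simp
  have "(\<integral>\<^sup>+ p. ennreal (?f p) \<partial>(\<mu> \<Otimes>\<^sub>M \<mu>)) \<noteq> \<infinity>"
  proof
    assume "(\<integral>\<^sup>+ p. ennreal (?f p) \<partial>(\<mu> \<Otimes>\<^sub>M \<mu>)) = \<infinity>"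
    with neg have "ext_integral (\<mu> \<Otimes>\<^sub>M \<mu>) ?f = \<infinity>"
      unfolding ext_integral_def
      by (cases "\<integral>\<^sup>+ p. ennreal (- ?f p) \<partial>(\<mu> \<Otimes>\<^sub>M \<mu>)") auto
    with fin show False
      by (simp add: energy_def)
  qed
  with neg show ?thesis
    unfolding real_integrable_def by auto
qed

lemma min_energy_le:
  fixes \<mu> :: "(real ^ 'n::finite) measure"
  assumes "0 < \<beta>" "\<beta> \<le> \<alpha>" "\<mu> \<in> borel_probs"
  shows "ereal (min_energy TYPE('n) \<alpha> \<beta>) \<le> energy \<alpha> \<beta> \<mu>"
  unfolding ereal_min_energy[OF assms(1,2)] using assms(3) by (rule INF_lower)

section \<open>Concavity of the minimal energy in the reciprocal exponent\<close>

lemma integrable_if_below: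
  fixes f g :: "'a \<Rightarrow> real"
  assumes "finite_measure M" "f \<in> borel_measurable M" "integrable M g"
    and "0 < u" "\<And>x. a \<le> f x" "\<And>x. u * f x \<le> g x"
  shows "integrable M f"
proof -
  interpret finite_measure M by fact
  show ?thesis
  proof (rule Bochner_Integration.integrable_bound)
    show "integrable M (\<lambda>x. \<bar>a\<bar> + \<bar>g x\<bar> / u)"
      using assms by auto
    show "AE x in M. norm (f x) \<le> norm (\<bar>a\<bar> + \<bar>g x\<bar> / u)"
    proof (rule AE_I2)
      fix x
      have "f x \<le> g x / u"
        using assms(4) assms(6)[of x] by (simp add: field_simps)
      also have "\<dots> \<le> \<bar>g x\<bar> / u"
        using assms(4) by (simp add: divide_right_mono)
      finally have "f x \<le> \<bar>g x\<bar> / u" .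
      moreover have "0 \<le> \<bar>g x\<bar> / u"
        using assms(4) by simp
      ultimately show "norm (f x) \<le> norm (\<bar>a\<bar> + \<bar>g x\<bar> / u)"
        using assms(5)[of x] by (auto simp: abs_if)
    qed
  qed fact
qed

text \<open>
  An infimum of concave functions is concave; the third point \<open>1 / \<alpha>\<close> of the combination does not
  show because the minimal energy is 0 there.
\<close>

lemma min_energy_reciprocal_concave:
  assumes \<beta>: "0 < \<beta>" "\<beta> \<le> \<alpha>" "0 < \<beta>\<^sub>0" "\<beta>\<^sub>0 \<le> \<alpha>" "0 < \<beta>\<^sub>1" "\<beta>\<^sub>1 \<le> \<alpha>"
    and u: "0 < u\<^sub>0" "0 < u\<^sub>1" "u\<^sub>0 + u\<^sub>1 \<le> 1"
    and b: "1 / \<beta> - 1 / \<alpha> = u\<^sub>0 * (1 / \<beta>\<^sub>0 - 1 / \<alpha>) + u\<^sub>1 * (1 / \<beta>\<^sub>1 - 1 / \<alpha>)"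
  shows "u\<^sub>0 * min_energy TYPE('n::finite) \<alpha> \<beta>\<^sub>0 + u\<^sub>1 * min_energy TYPE('n) \<alpha> \<beta>\<^sub>1
    \<le> min_energy TYPE('n) \<alpha> \<beta>"
proof -
  let ?E = "min_energy TYPE('n) \<alpha>"
  let ?f = "\<lambda>\<gamma> (x, y). interaction \<alpha> \<gamma> (x - y :: real ^ 'n)"
  have "ereal (u\<^sub>0 * ?E \<beta>\<^sub>0 + u\<^sub>1 * ?E \<beta>\<^sub>1) \<le> energy \<alpha> \<beta> \<mu>"
    if \<mu>: "\<mu> \<in> borel_probs" for \<mu> :: "(real ^ 'n) measure"
  proof (cases "energy \<alpha> \<beta> \<mu> = \<infinity>")
    case False
    interpret M: prob_space \<mu> using \<mu> by (simp add: borel_probs_def)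
    interpret P: pair_prob_space \<mu> \<mu> ..
    have sets [measurable_cong]: "sets \<mu> = sets borel"
      using \<mu> by (simp add: borel_probs_def)
    have pointwise: "u\<^sub>0 * ?f \<beta>\<^sub>0 p + u\<^sub>1 * ?f \<beta>\<^sub>1 p \<le> ?f \<beta> p" for p
      using interaction_reciprocal_concave[OF _ _ _ _ _ _ _ b] \<beta> u by (auto simp: split_beta)
    have below: "1 / \<alpha> - 1 / \<gamma> \<le> ?f \<gamma> p" if "0 < \<gamma>" "\<gamma> \<le> \<alpha>" for \<gamma> p
      using interaction_ge[OF that] by (auto simp: split_beta)
    have int: "integrable (\<mu> \<Otimes>\<^sub>M \<mu>) (?f \<beta>)"
      using \<beta> \<mu> False by (intro integrable_if_energy_finite)
    \<comment> \<open>As both weights are positive and both kernels are bounded below, each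
      kernel is dominated by the one for \<open>\<beta>\<close> up to a constant.\<close>
    have int0: "integrable (\<mu> \<Otimes>\<^sub>M \<mu>) (?f \<beta>\<^sub>0)"
    proof (rule integrable_if_below[OF P.finite_measure_axioms])
      show "integrable (\<mu> \<Otimes>\<^sub>M \<mu>) (\<lambda>p. ?f \<beta> p - u\<^sub>1 * (1 / \<alpha> - 1 / \<beta>\<^sub>1))"
        using int by (intro Bochner_Integration.integrable_diff) auto
      show "u\<^sub>0 * ?f \<beta>\<^sub>0 p \<le> ?f \<beta> p - u\<^sub>1 * (1 / \<alpha> - 1 / \<beta>\<^sub>1)" for p
        using pointwise[of p] mult_left_mono[OF below[OF \<beta>(5,6)], of u\<^sub>1 p] u by linarith
    qed (use below[OF \<beta>(3,4)] u in \<open>measurable\<close>)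
    have int1: "integrable (\<mu> \<Otimes>\<^sub>M \<mu>) (?f \<beta>\<^sub>1)"
    proof (rule integrable_if_below[OF P.finite_measure_axioms])
      show "integrable (\<mu> \<Otimes>\<^sub>M \<mu>) (\<lambda>p. ?f \<beta> p - u\<^sub>0 * (1 / \<alpha> - 1 / \<beta>\<^sub>0))"
        using int by (intro Bochner_Integration.integrable_diff) auto
      show "u\<^sub>1 * ?f \<beta>\<^sub>1 p \<le> ?f \<beta> p - u\<^sub>0 * (1 / \<alpha> - 1 / \<beta>\<^sub>0)" for p
        using pointwise[of p] mult_left_mono[OF below[OF \<beta>(3,4)], of u\<^sub>0 p] u by linarith
    qed (use below[OF \<beta>(5,6)] u in \<open>measurable\<close>)
    define I where "I \<gamma> = 1 / 2 * (\<integral>p. ?f \<gamma> p \<partial>(\<mu> \<Otimes>\<^sub>M \<mu>))" for \<gamma>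
    have "?E \<beta>\<^sub>0 \<le> I \<beta>\<^sub>0"
      using min_energy_le[OF \<beta>(3,4) \<mu>] energy_eq_integral[OF int0] by (simp add: I_def)
    moreover have "?E \<beta>\<^sub>1 \<le> I \<beta>\<^sub>1"
      using min_energy_le[OF \<beta>(5,6) \<mu>] energy_eq_integral[OF int1] by (simp add: I_def)
    ultimately have "u\<^sub>0 * ?E \<beta>\<^sub>0 + u\<^sub>1 * ?E \<beta>\<^sub>1 \<le> u\<^sub>0 * I \<beta>\<^sub>0 + u\<^sub>1 * I \<beta>\<^sub>1"
      using u by (intro add_mono mult_left_mono) auto
    also have "\<dots> = 1 / 2 * (\<integral>p. u\<^sub>0 * ?f \<beta>\<^sub>0 p + u\<^sub>1 * ?f \<beta>\<^sub>1 p \<partial>(\<mu> \<Otimes>\<^sub>M \<mu>))"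
      using int0 int1 by (simp add: I_def algebra_simps)
    also have "\<dots> \<le> I \<beta>"
      unfolding I_def using int int0 int1 pointwise
      by (intro mult_left_mono integral_mono) auto
    finally show ?thesis
      using energy_eq_integral[OF int] by (simp add: I_def)
  qed simp
  then have "ereal (u\<^sub>0 * ?E \<beta>\<^sub>0 + u\<^sub>1 * ?E \<beta>\<^sub>1) \<le> ereal (?E \<beta>)"
    unfolding ereal_min_energy[OF \<beta>(1,2)] by (intro INF_greatest)
  then show ?thesis by simp
qed

section \<open>The simplex as a competitor\<close>

text \<open>
  Equal multiples of the \<open>n\<close> coordinate vectors are equidistant, and one point on the diagonal can be
  placed at the same distance from all of them; it is indexed by \<open>None\<close>.
\<close>

lemma unit_simplex_exists:
  "\<exists>v :: 'n::finite option \<Rightarrow> real ^ 'n. \<forall>x y. x \<noteq> y \<longrightarrow> norm (v x - v y) = 1"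
proof -
  define n where "n = real CARD('n)"
  have n: "n \<ge> 1" by (simp add: n_def Suc_leI)
  define s :: real where "s = sqrt (1 / 2)"
  have s: "s * s = 1 / 2" by (simp add: s_def)
  \<comment> \<open>The positive root of \<open>n a\<^sup>2 - 2 s a - 1 / 2\<close>, which says that \<open>(a, ..., a)\<close> is at
    distance 1 from \<open>s e\<^sub>i\<close>.\<close>
  define a where "a = s * (1 + sqrt (1 + n)) / n"
  have q: "n * a\<^sup>2 - 2 * s * a + 1 / 2 = 1"
  proof -
    have "n\<^sup>2 * a\<^sup>2 = s * s * (1 + sqrt (1 + n))\<^sup>2"
      using n by (simp add: a_def power2_eq_square field_simps)
    also have "\<dots> = 1 / 2 * (2 + n + 2 * sqrt (1 + n))"
      using n unfolding s by (simp add: power2_sum)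
    also have "\<dots> = n * (2 * s * a) + n / 2"
    proof -
      have "n * (2 * s * a) = 2 * (s * s) * (1 + sqrt (1 + n))"
        using n by (simp add: a_def field_simps)
      then show ?thesis by (simp add: s)
    qed
    finally have "n * (n * a\<^sup>2 - 2 * s * a - 1 / 2) = 0"
      by (simp add: power2_eq_square algebra_simps)
    then show ?thesis using n by simp
  qed
  define c :: "real ^ 'n" where "c = (\<chi> i. a)"
  define v where "v x = (case x of None \<Rightarrow> c | Some i \<Rightarrow> axis i s)" for x
  have cc: "c \<bullet> c = n * a\<^sup>2"
    by (simp add: c_def inner_vec_def n_def power2_eq_square)
  have ca: "c \<bullet> axis i s = s * a" "axis i s \<bullet> c = s * a" for i
    by (simp_all add: c_def inner_axis inner_axis' mult.commute)
  have aa: "axis i s \<bullet> (axis j s :: real ^ 'n) = (if i = j then 1 / 2 else 0)" for i j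
    by (simp add: inner_axis_axis s)
  have "norm (v x - v y) = 1" if "x \<noteq> y" for x y
  proof -
    have "(v x - v y) \<bullet> (v x - v y) = 1"
      using that q by (cases x; cases y) (auto simp: v_def inner_diff cc ca aa algebra_simps)
    then show ?thesis by (simp add: norm_eq_sqrt_inner)
  qed
  then show ?thesis by blast
qed

text \<open>
  At distance 1 the interaction takes its minimum \<open>1 / \<alpha> - 1 / \<beta>\<close>, and the simplex has the most
  points of \<open>n\<close>-dimensional space that are pairwise at distance 1. For \<open>n + 1\<close> equally weighted
  points only the share \<open>1 / (n + 1)\<close> of pairs on the diagonal is lost.
\<close>

lemma min_energy_le_simplex:
  assumes \<beta>: "0 < \<beta>" "\<beta> \<le> \<alpha>"
  shows "min_energy TYPE('n::finite) \<alpha> \<beta>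
    \<le> - (1 / 2) * (real CARD('n) / (real CARD('n) + 1)) * (1 / \<beta> - 1 / \<alpha>)"
proof -
  obtain v :: "'n option \<Rightarrow> real ^ 'n" where v: "\<And>x y. x \<noteq> y \<Longrightarrow> norm (v x - v y) = 1"
    using unit_simplex_exists by blast
  define n where "n = real CARD('n)"
  define q where "q = 1 / \<beta> - 1 / \<alpha>"
  have q: "0 \<le> q" using \<beta> by (simp add: q_def field_simps)
  define N where "N = n + 1"
  have n: "0 < n" by (simp add: n_def)
  then have N: "0 < N" by (simp add: N_def)
  let ?U = "measure_pmf (pmf_of_set (UNIV :: 'n option set))"
  define \<mu> where "\<mu> = distr ?U borel v"
  let ?f = "\<lambda>(x, y). interaction \<alpha> \<beta> (x - y :: real ^ 'n)"
  have card: "real CARD('n option) = N"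
    by (simp add: n_def N_def)
  interpret M: prob_space \<mu>
    unfolding \<mu>_def by (rule measure_pmf.prob_space_distr) simp
  have sets [measurable_cong]: "sets \<mu> = sets borel"
    by (simp add: \<mu>_def)
  have \<mu>: "\<mu> \<in> borel_probs"
    using M.prob_space_axioms by (simp add: borel_probs_def sets)
  have double_sum: "(\<integral>\<^sup>+ p. g p \<partial>(\<mu> \<Otimes>\<^sub>M \<mu>)) =
      (\<Sum>x\<in>UNIV. (\<Sum>y\<in>UNIV. g (v x, v y)) / N) / N"
    if [measurable]: "g \<in> borel_measurable (borel \<Otimes>\<^sub>M borel)" for g
  proof -
    have "(\<integral>\<^sup>+ p. g p \<partial>(\<mu> \<Otimes>\<^sub>M \<mu>)) = (\<integral>\<^sup>+ x. \<integral>\<^sup>+ y. g (x, y) \<partial>\<mu> \<partial>\<mu>)"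
      by (rule M.nn_integral_fst[symmetric]) measurable
    also have "\<dots> = (\<integral>\<^sup>+ x. \<integral>\<^sup>+ y. g (v x, v y) \<partial>?U \<partial>?U)"
      unfolding \<mu>_def by (subst nn_integral_distr; (subst nn_integral_distr)?) simp_all
    also have "\<dots> = (\<Sum>x\<in>UNIV. (\<Sum>y\<in>UNIV. g (v x, v y)) / N) / N"
      by (simp add: nn_integral_pmf_of_set card[symmetric] ennreal_of_nat_eq_real_of_nat del: card_option)
    finally show ?thesis .
  qed
  have f: "interaction \<alpha> \<beta> (v x - v y) = (if x = y then 0 else - q)" for x y
    using v[of x y] by (auto simp: interaction_def q_def)
  have "(\<integral>\<^sup>+ p. ennreal (?f p) \<partial>(\<mu> \<Otimes>\<^sub>M \<mu>)) = 0"
    using q by (subst double_sum) (auto simp: f ennreal_neg)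
  moreover have "(\<integral>\<^sup>+ p. ennreal (- ?f p) \<partial>(\<mu> \<Otimes>\<^sub>M \<mu>)) = ennreal (n / N * q)"
  proof -
    have row: "(\<Sum>y\<in>UNIV. ennreal (- interaction \<alpha> \<beta> (v x - v y))) = ennreal (n * q)" for x
    proof -
      have "(\<Sum>y\<in>UNIV. ennreal (- interaction \<alpha> \<beta> (v x - v y))) = ennreal (\<Sum>y\<in>UNIV. if y = x then 0 else q)"
        using q by (subst sum_ennreal[symmetric]) (auto simp: f intro!: sum.cong arg_cong[where f = ennreal])
      also have "(\<Sum>y\<in>UNIV. if y = x then 0 else q) = (\<Sum>y\<in>UNIV - {x}. q)"
        by (intro sum.mono_neutral_cong_right) auto
      also have "\<dots> = n * q"
        by (simp add: card_Diff_singleton n_def)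
      finally show ?thesis .
    qed
    have "(\<integral>\<^sup>+ p. ennreal (- ?f p) \<partial>(\<mu> \<Otimes>\<^sub>M \<mu>))
        = (\<Sum>x\<in>(UNIV :: 'n option set). ennreal (n * q / N)) / N"
      using n N q by (subst double_sum) (simp_all add: row divide_ennreal del: sum_constant)
    also have "\<dots> = ennreal (N * (n * q / N) / N)"
      using n N q by (subst sum_ennreal) (auto simp: divide_ennreal card simp del: card_option)
    finally show ?thesis
      using N by simp
  qed
  ultimately have "energy \<alpha> \<beta> \<mu> = ereal (- (1 / 2) * (n / (n + 1)) * q)"
    using n q by (simp add: N_def energy_def ext_integral_def enn2ereal_ennreal zero_ennreal.rep_eq distrib_left)
  then show ?thesis
    using min_energy_le[OF \<beta> \<mu>] by (simp add: n_def q_def)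
qed

section \<open>Strong concavity\<close>

lemma reciprocal_convexity_gap:
  fixes x\<^sub>0 x\<^sub>1 t :: real
  assumes "x\<^sub>0 \<noteq> 0" "x\<^sub>1 \<noteq> 0" "(1 - t) * x\<^sub>0 + t * x\<^sub>1 \<noteq> 0"
  shows "(1 - t) / x\<^sub>0 + t / x\<^sub>1 - 1 / ((1 - t) * x\<^sub>0 + t * x\<^sub>1)
    = t * (1 - t) * (x\<^sub>0 - x\<^sub>1)\<^sup>2 / (x\<^sub>0 * x\<^sub>1 * ((1 - t) * x\<^sub>0 + t * x\<^sub>1))"
proof -
  define x where "x = (1 - t) * x\<^sub>0 + t * x\<^sub>1"
  have "((1 - t) / x\<^sub>0 + t / x\<^sub>1 - 1 / x) * (x\<^sub>0 * x\<^sub>1 * x)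
      = ((1 - t) * x\<^sub>1 + t * x\<^sub>0) * x - x\<^sub>0 * x\<^sub>1"
    using assms unfolding x_def[symmetric] by (simp add: field_simps)
  also have "\<dots> = t * (1 - t) * (x\<^sub>0 - x\<^sub>1)\<^sup>2"
    unfolding x_def by algebra
  finally show ?thesis
    using assms unfolding x_def[symmetric] by (simp add: eq_divide_eq)
qed

text \<open>
  With \<open>q \<gamma> = 1 / \<gamma> - 1 / \<alpha>\<close>, the value \<open>q x\<close> falls short of \<open>Y = (1 - t) * q x\<^sub>0 + t * q x\<^sub>1\<close>.
  Put \<open>q x = \<theta> * Y\<close>. Concavity with the weights \<open>\<theta> * (1 - t)\<close> and \<open>\<theta> * t\<close> bounds \<open>E x\<close> below
  by \<open>\<theta>\<close> times the interpolated value \<open>S\<close>. As \<open>S\<close> is at most \<open>- n / (2 * (n + 1)) * Y\<close> by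
  the simplex bound, dropping the share \<open>1 - \<theta>\<close> of it gains \<open>n / (2 * (n + 1))\<close> times
  \<open>(1 - \<theta>) * Y = Y - q x\<close>, which is the convexity gap of the reciprocal.
\<close>

lemma min_energy_concavity_gap:
  fixes x\<^sub>0 x\<^sub>1 :: real
  assumes x: "0 < x\<^sub>0" "x\<^sub>0 \<le> \<alpha>" "0 < x\<^sub>1" "x\<^sub>1 \<le> \<alpha>" and t: "0 \<le> t" "t \<le> 1"
  defines "x \<equiv> (1 - t) * x\<^sub>0 + t * x\<^sub>1" and "n \<equiv> real CARD('n::finite)"
    and "E \<equiv> min_energy TYPE('n) \<alpha>"
  shows "(1 - t) * E x\<^sub>0 + t * E x\<^sub>1 + n / (2 * (n + 1)) * ((1 - t) / x\<^sub>0 + t / x\<^sub>1 - 1 / x) \<le> E x"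
proof (cases "t = 0 \<or> t = 1 \<or> x\<^sub>0 = x\<^sub>1")
  case True
  then have "x = x\<^sub>0 \<and> t = 0 \<or> x = x\<^sub>1 \<and> t = 1 \<or> x = x\<^sub>0 \<and> x\<^sub>0 = x\<^sub>1"
    by (auto simp: x_def algebra_simps)
  then show ?thesis
    by (elim disjE conjE) (simp_all add: algebra_simps diff_divide_distrib)
next
  case False
  then have t': "0 < t" "t < 1" and ne: "x\<^sub>0 \<noteq> x\<^sub>1" using t by auto
  have xpos: "0 < x"
    unfolding x_def using x t' by (intro add_pos_pos mult_pos_pos) auto
  have x\<alpha>: "x < \<alpha>"
  proof -
    have "x\<^sub>0 < \<alpha> \<or> x\<^sub>1 < \<alpha>" using x ne by auto
    then have "(1 - t) * x\<^sub>0 + t * x\<^sub>1 < (1 - t) * \<alpha> + t * \<alpha>"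
    proof
      assume "x\<^sub>0 < \<alpha>"
      then show ?thesis using x t' by (intro add_less_le_mono) auto
    next
      assume "x\<^sub>1 < \<alpha>"
      then show ?thesis using x t' by (intro add_le_less_mono) auto
    qed
    then show ?thesis by (simp add: x_def algebra_simps)
  qed
  define q where "q \<gamma> = 1 / \<gamma> - 1 / \<alpha>" for \<gamma>
  define Y where "Y = (1 - t) * q x\<^sub>0 + t * q x\<^sub>1"
  define S where "S = (1 - t) * E x\<^sub>0 + t * E x\<^sub>1"
  define \<theta> where "\<theta> = q x / Y"
  define c where "c = n / (2 * (n + 1))"
  have gap: "(1 - t) / x\<^sub>0 + t / x\<^sub>1 - 1 / x = Y - q x"
    by (simp add: Y_def q_def algebra_simps diff_divide_distrib)
  have qx: "0 < q x"
    using xpos x\<alpha> by (simp add: q_def frac_less2)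
  have "0 \<le> (1 - t) / x\<^sub>0 + t / x\<^sub>1 - 1 / x"
    using x t' xpos reciprocal_convexity_gap[of x\<^sub>0 x\<^sub>1 t]
    unfolding x_def[symmetric] by simp
  then have "0 \<le> Y - q x"
    unfolding gap .
  with qx have Y: "0 < Y" "q x \<le> Y" by auto
  have \<theta>: "0 < \<theta>" "\<theta> \<le> 1" "\<theta> * Y = q x"
    using qx Y by (auto simp: \<theta>_def)
  have bound: "E \<gamma> \<le> - c * q \<gamma>" if "0 < \<gamma>" "\<gamma> \<le> \<alpha>" for \<gamma>
    using min_energy_le_simplex[OF that, where 'n = 'n]
    by (simp add: E_def c_def q_def n_def)
  have "S \<le> (1 - t) * (- c * q x\<^sub>0) + t * (- c * q x\<^sub>1)"
    unfolding S_def using x t by (intro add_mono mult_left_mono bound) auto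
  also have "\<dots> = - c * Y"
    by (simp add: Y_def algebra_simps)
  finally have S: "S \<le> - c * Y" .
  have "\<theta> * (1 - t) * E x\<^sub>0 + \<theta> * t * E x\<^sub>1 \<le> E x"
    unfolding E_def
  proof (rule min_energy_reciprocal_concave)
    show "1 / x - 1 / \<alpha>
        = \<theta> * (1 - t) * (1 / x\<^sub>0 - 1 / \<alpha>) + \<theta> * t * (1 / x\<^sub>1 - 1 / \<alpha>)"
      using \<theta>(3) by (simp add: Y_def q_def[symmetric] distrib_left mult.assoc)
    show "\<theta> * (1 - t) + \<theta> * t \<le> 1"
      using \<theta>(2) by (simp add: algebra_simps)
  qed (use x xpos x\<alpha> \<theta> t' in auto)
  then have "\<theta> * S \<le> E x"
    by (simp add: S_def algebra_simps)
  moreover have "(1 - \<theta>) * S \<le> (1 - \<theta>) * (- c * Y)"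
    using S \<theta> by (intro mult_left_mono) auto
  moreover have "(1 - \<theta>) * (- c * Y) = - c * (Y - q x)"
    using \<theta>(3) by (simp add: algebra_simps)
  moreover have "S = \<theta> * S + (1 - \<theta>) * S"
    by algebra
  ultimately have "S + c * (Y - q x) \<le> E x"
    by linarith
  then show ?thesis
    unfolding gap S_def c_def .
qed

theorem proposition1p7:
  fixes \<alpha> \<beta>\<^sub>0 \<beta>\<^sub>1 :: real
  assumes "0 < \<beta>\<^sub>0" "\<beta>\<^sub>0 < \<beta>\<^sub>1" "\<beta>\<^sub>1 \<le> \<alpha>"
  shows "let n = real CARD('n::finite); E = min_energy TYPE('n) \<alpha> in
      strongly_concave_on \<beta>\<^sub>0 \<beta>\<^sub>1
        (1 / (2 * \<beta>\<^sub>1\<^sup>2) * (n / (n + 1)) * (1 / \<beta>\<^sub>1 - 1 / \<alpha>)) E \<and>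
      (\<forall>t\<in>{0..1}. \<forall>\<beta>\<^sub>t. \<beta>\<^sub>t = (1 - t) * \<beta>\<^sub>0 + t * \<beta>\<^sub>1 \<longrightarrow>
        E \<beta>\<^sub>t \<ge> (1 - t) * E \<beta>\<^sub>0 + t * E \<beta>\<^sub>1
          + t * (1 - t) / (4 * \<beta>\<^sub>1\<^sup>2) * (n / (n + 1)) * (1 / \<beta>\<^sub>1 - 1 / \<alpha>) * (\<beta>\<^sub>1 - \<beta>\<^sub>0)\<^sup>2)"
proof -
  define n where "n = real CARD('n)"
  define E where "E = min_energy TYPE('n) \<alpha>"
  define m where "m = 1 / (2 * \<beta>\<^sub>1\<^sup>2) * (n / (n + 1)) * (1 / \<beta>\<^sub>1 - 1 / \<alpha>)"
  have n: "0 < n" by (simp add: n_def)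
  have concave: "strongly_concave_on \<beta>\<^sub>0 \<beta>\<^sub>1 m E"
    unfolding strongly_concave_on_def
  proof (intro ballI)
    fix x\<^sub>0 x\<^sub>1 t :: real
    assume "x\<^sub>0 \<in> {\<beta>\<^sub>0..\<beta>\<^sub>1}" "x\<^sub>1 \<in> {\<beta>\<^sub>0..\<beta>\<^sub>1}" "t \<in> {0..1}"
    then have x: "0 < x\<^sub>0" "x\<^sub>0 \<le> \<beta>\<^sub>1" "0 < x\<^sub>1" "x\<^sub>1 \<le> \<beta>\<^sub>1" and t: "0 \<le> t" "t \<le> 1"
      using assms by auto
    define x where "x = (1 - t) * x\<^sub>0 + t * x\<^sub>1"
    define d where "d = t * (1 - t) * (x\<^sub>0 - x\<^sub>1)\<^sup>2"
    have d: "0 \<le> d" using t by (simp add: d_def)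
    have xle: "x \<le> \<beta>\<^sub>1"
      unfolding x_def using x t by (intro convex_bound_le) auto
    have xpos: "0 < x"
      unfolding x_def using convex_bound_lt[of "- x\<^sub>0" 0 "- x\<^sub>1" "1 - t" t] x t by simp
    have m: "m \<le> n / (n + 1) * (1 / \<beta>\<^sub>1 ^ 3)"
    proof -
      have "1 / (2 * \<beta>\<^sub>1\<^sup>2) * (1 / \<beta>\<^sub>1 - 1 / \<alpha>) \<le> 1 / \<beta>\<^sub>1\<^sup>2 * (1 / \<beta>\<^sub>1)"
        using assms by (intro mult_mono) (auto simp: field_simps)
      then have "n / (n + 1) * (1 / (2 * \<beta>\<^sub>1\<^sup>2) * (1 / \<beta>\<^sub>1 - 1 / \<alpha>))
          \<le> n / (n + 1) * (1 / \<beta>\<^sub>1\<^sup>2 * (1 / \<beta>\<^sub>1))"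
        using n by (intro mult_left_mono) auto
      then show ?thesis
        by (simp add: m_def power3_eq_cube power2_eq_square mult_ac)
    qed
    have "x\<^sub>0 * x\<^sub>1 * x \<le> \<beta>\<^sub>1 ^ 3"
      using x xle xpos assms unfolding power3_eq_cube by (intro mult_mono) auto
    then have cube: "d / \<beta>\<^sub>1 ^ 3 \<le> d / (x\<^sub>0 * x\<^sub>1 * x)"
      using d x xpos assms by (intro divide_left_mono) auto
    have "t * (1 - t) * (m / 2) * (x\<^sub>0 - x\<^sub>1)\<^sup>2 = d / 2 * m"
      by (simp add: d_def)
    also have "\<dots> \<le> d / 2 * (n / (n + 1) * (1 / \<beta>\<^sub>1 ^ 3))"
      using d m by (intro mult_left_mono) auto
    also have "\<dots> = n / (2 * (n + 1)) * (d / \<beta>\<^sub>1 ^ 3)"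
      by (simp add: algebra_simps)
    also have "\<dots> \<le> n / (2 * (n + 1)) * (d / (x\<^sub>0 * x\<^sub>1 * x))"
      using n cube by (intro mult_left_mono) auto
    also have "d / (x\<^sub>0 * x\<^sub>1 * x) = (1 - t) / x\<^sub>0 + t / x\<^sub>1 - 1 / x"
      using reciprocal_convexity_gap[of x\<^sub>0 x\<^sub>1 t] x xpos unfolding x_def d_def by simp
    finally show "(1 - t) * E x\<^sub>0 + t * E x\<^sub>1 + t * (1 - t) * (m / 2) * (x\<^sub>0 - x\<^sub>1)\<^sup>2
        \<le> E ((1 - t) * x\<^sub>0 + t * x\<^sub>1)"
      using min_energy_concavity_gap[of x\<^sub>0 \<alpha> x\<^sub>1 t, where 'n = 'n] x t assms
      unfolding n_def E_def x_def by linarith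
  qed
  have "(1 - t) * E \<beta>\<^sub>0 + t * E \<beta>\<^sub>1
      + t * (1 - t) / (4 * \<beta>\<^sub>1\<^sup>2) * (n / (n + 1)) * (1 / \<beta>\<^sub>1 - 1 / \<alpha>) * (\<beta>\<^sub>1 - \<beta>\<^sub>0)\<^sup>2
      \<le> E ((1 - t) * \<beta>\<^sub>0 + t * \<beta>\<^sub>1)" if "t \<in> {0..1}" for t
  proof -
    have "t * (1 - t) / (4 * \<beta>\<^sub>1\<^sup>2) * (n / (n + 1)) * (1 / \<beta>\<^sub>1 - 1 / \<alpha>) * (\<beta>\<^sub>1 - \<beta>\<^sub>0)\<^sup>2
        = t * (1 - t) * (m / 2) * (\<beta>\<^sub>0 - \<beta>\<^sub>1)\<^sup>2"
      by (simp add: m_def power2_commute)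
    moreover have "\<beta>\<^sub>0 \<in> {\<beta>\<^sub>0..\<beta>\<^sub>1}" "\<beta>\<^sub>1 \<in> {\<beta>\<^sub>0..\<beta>\<^sub>1}"
      using assms by auto
    ultimately show ?thesis
      using concave that unfolding strongly_concave_on_def by metis
  qed
  with concave show ?thesis
    by (simp add: Let_def n_def E_def m_def)
qed

end
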